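(* Let $S$ be a closed subsemigroup of $\mathbb{N}^\mathbb{N}$ with $|S|=2^{\aleph_0}$. Then there exists a closed subsemigroup $T$ of $\mathfrak{F}_2$ such that $|T| = 2^{\aleph_0}$ and $T\preccurlyeq S$.
   Context: $\mathbb{N}=\{0,1,2,\ldots\}$ and $\mathbb{N}^\mathbb{N}$ is the semigroup of all maps $\mathbb{N}\to\mathbb{N}$ under composition, equipped with the product topology arising from the discrete topology on $\mathbb{N}$; "closed" refers to this topology. $\mathfrak{F}_2=\{f\in\mathbb{N}^\mathbb{N} : |f(\mathbb{N})|\leq 2\}$. For $U,V\subseteq\mathbb{N}^\mathbb{N}$, write $U\preccurlyeq V$ if there is a countable $C\subseteq\mathbb{N}^\mathbb{N}$ such that $U$ is contained in the subsemigroup of $\mathbb{N}^\mathbb{N}$ generated by $V\cup C$. *)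

theory Defs
  imports "HOL-Analysis.Analysis" "HOL-Library.Equipollence"
begin

text \<open>
  The library topology on the type \<open>nat \<Rightarrow> nat\<close> is the product topology of the discrete
  topology on \<open>nat\<close>, so \<open>closed\<close> is used as it stands. Subsemigroups may be empty; hence
  \<open>subsemigroup hull X\<close> is the subsemigroup generated by \<open>X\<close> (empty for \<open>X = {}\<close>).
\<close>

definition subsemigroup :: "(nat \<Rightarrow> nat) set \<Rightarrow> bool" where
  "subsemigroup S \<longleftrightarrow> (\<forall>f\<in>S. \<forall>g\<in>S. f \<circ> g \<in> S)"

definition F2 :: "(nat \<Rightarrow> nat) set" where
  "F2 = {f. finite (range f) \<and> card (range f) \<le> 2}"

definition gen_le :: "(nat \<Rightarrow> nat) set \<Rightarrow> (nat \<Rightarrow> nat) set \<Rightarrow> bool" (infix "\<preccurlyeq>" 50) where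
  "U \<preccurlyeq> V \<longleftrightarrow> (\<exists>C. countable C \<and> U \<subseteq> subsemigroup hull (V \<union> C))"

end

theory Submission
  imports Defs
begin

text \<open>
  It suffices to find a two-colouring \<open>a\<close> of \<open>\<nat>\<close> and a continuous map \<open>g\<close> from Cantor space into
  \<open>S\<close> such that \<open>x \<mapsto> a \<circ> g x\<close> is injective: the compact set of all \<open>a \<circ> g x \<circ> (\<lambda>n. n - 2)\<close>
  becomes a semigroup after adding two constant maps, since its elements take values in \<open>{0, 1}\<close>
  and agree at \<open>0\<close> and \<open>1\<close>. A Cantor scheme yields \<open>g\<close> as soon as \<open>s \<mapsto> a \<circ> s\<close> is nowhere locally
  constant on some nonempty \<open>P \<subseteq> S\<close>. If the generic \<open>a\<close> has this property on the set of
  condensation points of \<open>S\<close>, we are done. Otherwise, some finite part of a colouring forces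
  \<open>s \<mapsto> a \<circ> s\<close> to be constant on an uncountable piece \<open>U\<close> of \<open>S\<close>; then the members of \<open>U\<close>
  differ from each other only in values below some fixed \<open>l\<close>, and one of the finitely many
  colourings \<open>v \<le> k\<close> with \<open>k < l\<close> takes \<open>U\<close> to an uncountable set.
\<close>

section \<open>Cylinder sets and the topology of sequence spaces\<close>

definition cyl :: "(nat \<Rightarrow> 'a) \<Rightarrow> nat \<Rightarrow> (nat \<Rightarrow> 'a) set" where
  "cyl s m = {t. \<forall>i<m. t i = s i}"

lemma mem_cyl: "t \<in> cyl s m \<longleftrightarrow> (\<forall>i<m. t i = s i)"
  by (simp add: cyl_def)

lemma cyl_antimono: "m \<le> n \<Longrightarrow> cyl s n \<subseteq> cyl s m"
  by (auto simp: cyl_def)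

lemma countable_cylinders: "countable (range (\<lambda>(s::nat \<Rightarrow> 'a::countable, m). cyl s m))"
proof -
  have "range (\<lambda>(s::nat \<Rightarrow> 'a, m). cyl s m) \<subseteq> range (\<lambda>p. {t. map t [0..<length p] = p})"
  proof clarify
    fix s :: "nat \<Rightarrow> 'a" and m
    have "cyl s m = (\<lambda>p. {t. map t [0..<length p] = p}) (map s [0..<m])"
      by (auto simp: cyl_def)
    then show "cyl s m \<in> range (\<lambda>p. {t. map t [0..<length p] = p})"
      by blast
  qed
  then show ?thesis
    by (rule countable_subset) simp
qed

lemma open_cyl:
  fixes s :: "nat \<Rightarrow> 'a::discrete_topology"
  shows "open (cyl s m)"
proof -
  have "cyl s m = (\<Inter>i\<in>{..<m}. (\<lambda>t. t i) -` {s i})"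
    by (auto simp: cyl_def)
  moreover have "open ((\<lambda>t::nat \<Rightarrow> 'a. t i) -` {s i})" for i
    by (intro open_vimage continuous_on_product_coordinates open_discrete)
  ultimately show ?thesis
    by (simp add: open_INT)
qed

text \<open>Coordinate \<open>i\<close> of \<open>g x\<close> depends only on the first
  \<open>M i\<close> entries of \<open>x\<close>, so the preimage of any set under it is a union of
  cylinders.\<close>

lemma continuous_on_cylwise:
  fixes g :: "(nat \<Rightarrow> 'a::discrete_topology) \<Rightarrow> (nat \<Rightarrow> 'b::topological_space)"
  assumes "\<And>x y i. y \<in> cyl x (M i) \<Longrightarrow> g y i = g x i"
  shows "continuous_on UNIV g"
proof (rule continuous_on_coordinatewise_then_product)
  fix i
  show "continuous_on UNIV (\<lambda>x. g x i)"
  proof (subst continuous_on_open_vimage[OF open_UNIV], intro allI impI)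
    fix B :: "'b set"
    have "(\<lambda>x. g x i) -` B = (\<Union>x\<in>(\<lambda>x. g x i) -` B. cyl x (M i))"
    proof (intro set_eqI iffI)
      fix y
      assume "y \<in> (\<Union>x\<in>(\<lambda>x. g x i) -` B. cyl x (M i))"
      then obtain x where "g x i \<in> B" "y \<in> cyl x (M i)"
        by blast
      then show "y \<in> (\<lambda>x. g x i) -` B"
        using assms[of y x i] by simp
    qed (auto simp: mem_cyl)
    then show "open ((\<lambda>x. g x i) -` B \<inter> UNIV)"
      by (metis (no_types, lifting) open_UN open_cyl inf_top_right)
  qed
qed

lemma mem_closed_if_approximated:
  fixes S :: "(nat \<Rightarrow> 'a::topological_space) set"
  assumes "closed S" and "\<And>k. \<exists>t\<in>S. t \<in> cyl s k"
  shows "s \<in> S"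
proof -
  obtain t where t: "\<And>k. t k \<in> S" "\<And>k. t k \<in> cyl s k"
    using assms(2) by metis
  have "(\<lambda>k. t k i) \<longlonglongrightarrow> s i" for i
    using t(2) by (intro tendsto_eventually eventually_sequentiallyI[of "Suc i"]) (auto simp: mem_cyl)
  then have "limitin (product_topology (\<lambda>_. euclidean) UNIV) t s sequentially"
    by (simp add: limitin_componentwise)
  then have "t \<longlonglongrightarrow> s"
    by (simp add: euclidean_product_topology)
  then show ?thesis
    using assms(1) t(1) by (meson closed_sequentially)
qed

lemma compact_UNIV_nat_bool: "compact (UNIV :: (nat \<Rightarrow> bool) set)"
proof -
  have "compact_space (product_topology (\<lambda>_. euclidean :: bool topology) (UNIV :: nat set))"
    unfolding compact_space_product_topology
    by (simp add: compact_space_def finite_imp_compact)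
  then show ?thesis
    by (simp add: euclidean_product_topology compact_space_def)
qed


lemma compact_imp_closed_fun:
  fixes K :: "('a \<Rightarrow> 'b::t2_space) set"
  assumes "compact K"
  shows "closed K"
proof -
  have "Hausdorff_space (euclidean :: 'b topology)"
    unfolding Hausdorff_space_def using hausdorff by (fastforce simp: disjnt_def)
  then have "Hausdorff_space (product_topology (\<lambda>_. euclidean :: 'b topology) (UNIV :: 'a set))"
    unfolding Hausdorff_space_product_topology by simp
  then have "Hausdorff_space (euclidean :: ('a \<Rightarrow> 'b) topology)"
    by (simp add: euclidean_product_topology)
  then show ?thesis
    using assms compactin_imp_closedin[of euclidean K] by simp
qed

section \<open>Cantor schemes\<close>

definition nowhere_locally_constant_on :: "(nat \<Rightarrow> 'a) set \<Rightarrow> ((nat \<Rightarrow> 'a) \<Rightarrow> 'b) \<Rightarrow> bool" where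
  "nowhere_locally_constant_on P f \<longleftrightarrow>
    (\<forall>s\<in>P. \<forall>m. \<exists>t\<in>P \<inter> cyl s m. \<exists>u\<in>P \<inter> cyl s m. f t \<noteq> f u)"

text \<open>Each bit of \<open>x\<close> chooses between two members of \<open>P\<close> that share
  the prefix fixed so far but get different colours under \<open>a\<close> at some later position.
  The values of \<open>g\<close> are limits of members of \<open>P\<close>; whether they lie in
  \<open>P\<close> is left open.\<close>

lemma cantor_scheme:
  fixes P :: "(nat \<Rightarrow> 'a::topological_space) set" and a :: "'a \<Rightarrow> 'b"
  assumes "P \<noteq> {}" and "nowhere_locally_constant_on P (\<lambda>s. a \<circ> s)"
  obtains g :: "(nat \<Rightarrow> bool) \<Rightarrow> nat \<Rightarrow> 'a"
  where "continuous_on UNIV g" and "\<And>x k. \<exists>t\<in>P. t \<in> cyl (g x) k" and "inj (\<lambda>x. a \<circ> g x)"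
proof -
  obtain s0 where "s0 \<in> P"
    using assms(1) by blast
  have "\<exists>t u n. t \<in> P \<inter> cyl s m \<and> u \<in> P \<inter> cyl s m \<and> a (t n) \<noteq> a (u n)" if "s \<in> P" for s m
    using assms(2) that unfolding nowhere_locally_constant_on_def by (fastforce simp: fun_eq_iff)
  then obtain t n where t: "\<And>s m b. s \<in> P \<Longrightarrow> t b s m \<in> P \<inter> cyl s m"
    and n: "\<And>s m. s \<in> P \<Longrightarrow> a (t False s m (n s m)) \<noteq> a (t True s m (n s m))"
  proof -
    assume *: "\<And>t n. (\<And>s m b. s \<in> P \<Longrightarrow> t b s m \<in> P \<inter> cyl s m) \<Longrightarrow>
      (\<And>s m. s \<in> P \<Longrightarrow> a (t False s m (n s m)) \<noteq> a (t True s m (n s m))) \<Longrightarrow> thesis"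
    assume "\<And>s m. s \<in> P \<Longrightarrow> \<exists>t u n. t \<in> P \<inter> cyl s m \<and> u \<in> P \<inter> cyl s m \<and> a (t n) \<noteq> a (u n)"
    then obtain t u n where "\<And>s m. s \<in> P \<Longrightarrow> t s m \<in> P \<inter> cyl s m"
      "\<And>s m. s \<in> P \<Longrightarrow> u s m \<in> P \<inter> cyl s m" "\<And>s m. s \<in> P \<Longrightarrow> a (t s m (n s m)) \<noteq> a (u s m (n s m))"
      by metis
    then show thesis
      by (intro *[of "\<lambda>b. if b then u else t" n]) auto
  qed
  have n_ge: "m \<le> n s m" if "s \<in> P" for s m
  proof (rule ccontr)
    assume "\<not> m \<le> n s m"
    then have "t False s m (n s m) = t True s m (n s m)"
      using t[OF that, of False m] t[OF that, of True m] by (simp add: mem_cyl)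
    then show False
      using n[OF that, of m] by simp
  qed
  \<comment> \<open>The state \<open>(s, m)\<close> holds the current member of \<open>P\<close> and
    the length of the prefix already fixed. The new length \<open>Suc (n s m)\<close> just includes
    the position where the two branches differ.\<close>
  define G where "G x = rec_nat (s0, 0) (\<lambda>k (s, m). (t (x k) s m, Suc (n s m)))" for x :: "nat \<Rightarrow> bool"
  define r where "r x k = fst (G x k)" for x k
  define l where "l x k = snd (G x k)" for x k
  have r_0: "r x 0 = s0" and l_0: "l x 0 = 0"
    and r_Suc: "r x (Suc k) = t (x k) (r x k) (l x k)"
    and l_Suc: "l x (Suc k) = Suc (n (r x k) (l x k))" for x k
    by (simp_all add: r_def l_def G_def split_beta)
  have r_in: "r x k \<in> P" for x k
    by (induction k) (use t \<open>s0 \<in> P\<close> in \<open>auto simp: r_0 r_Suc\<close>)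
  have l_less: "l x k < l x (Suc k)" for x k
    using n_ge[OF r_in] by (simp add: l_Suc less_Suc_eq_le)
  have l_ge: "k \<le> l x k" for x k
  proof (induction k)
    case (Suc k)
    then show ?case
      using l_less[of x k] by simp
  qed simp
  have r_agree: "r x j \<in> cyl (r x k) (l x k)" if "k \<le> j" for x j k
    using that
  proof (induction j rule: dec_induct)
    case base
    then show ?case
      by (simp add: mem_cyl)
  next
    case (step j)
    have "r x (Suc j) \<in> cyl (r x j) (l x j)"
      using t[OF r_in] by (simp add: r_Suc)
    moreover have "l x k \<le> l x j"
      using step(1) l_less by (metis lift_Suc_mono_le less_imp_le)
    ultimately show ?case
      using step.IH by (simp add: mem_cyl)
  qed
  \<comment> \<open>Entry \<open>i\<close> is settled by stage \<open>Suc i\<close>, because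
    \<open>l x (Suc i)\<close> is at least \<open>Suc i\<close>.\<close>
  define g where "g x i = r x (Suc i) i" for x i
  have g_r: "g x i = r x k i" if "i < l x k" for x i k
  proof (cases "Suc i \<le> k")
    case True
    then show ?thesis
      using r_agree[OF True, of x] l_ge[of "Suc i" x] by (simp add: mem_cyl g_def)
  next
    case False
    then show ?thesis
      using r_agree[of k "Suc i" x] that by (simp add: mem_cyl g_def)
  qed
  \<comment> \<open>Stage \<open>k\<close> reads only the bits below \<open>k\<close>; this makes
    \<open>Suc\<close> a modulus of continuity for \<open>g\<close>.\<close>
  have local: "r x k = r y k \<and> l x k = l y k" if "y \<in> cyl x k" for x y k
    using that by (induction k) (auto simp: mem_cyl r_0 l_0 r_Suc l_Suc)
  show thesis
  proof
    show "continuous_on UNIV g"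
      by (rule continuous_on_cylwise[where M = Suc]) (use local in \<open>auto simp: g_def\<close>)
    show "\<exists>t\<in>P. t \<in> cyl (g x) k" for x k
    proof (intro bexI[OF _ r_in])
      show "r x k \<in> cyl (g x) k"
        using g_r[of _ x k] l_ge[of k x] by (simp add: mem_cyl)
    qed
    show "inj (\<lambda>x. a \<circ> g x)"
    proof (rule injI, rule ccontr)
      fix x y
      assume eq: "a \<circ> g x = a \<circ> g y" and "x \<noteq> y"
      \<comment> \<open>At the first bit where \<open>x\<close> and \<open>y\<close> differ, both
        are in the same state and take opposite branches. The resulting difference lies in the
        prefix fixed next, so it persists in \<open>g x\<close> and \<open>g y\<close>.\<close>
      then obtain k where k: "x k \<noteq> y k" "\<And>i. i < k \<Longrightarrow> x i = y i"
        using exists_least_iff[of "\<lambda>k. x k \<noteq> y k"] by (auto simp: fun_eq_iff)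
      define s m where "s = r x k" and "m = l x k"
      have "r y k = s" "l y k = m"
        using local[of y x k] k(2) by (auto simp: mem_cyl s_def m_def)
      then have "g x (n s m) = t (x k) s m (n s m)" "g y (n s m) = t (y k) s m (n s m)"
        using g_r[of "n s m" x "Suc k"] g_r[of "n s m" y "Suc k"]
        by (simp_all add: r_Suc l_Suc flip: s_def m_def)
      moreover have "a (t (x k) s m (n s m)) \<noteq> a (t (y k) s m (n s m))"
        using k(1) n[of s m] r_in[of x k] by (cases "x k"; cases "y k") (auto simp: s_def)
      ultimately show False
        using fun_cong[OF eq, of "n s m"] by simp
    qed
  qed
qed

section \<open>Condensation points, with size measured in the image under \<open>f\<close>\<close>

definition condensation :: "(nat \<Rightarrow> 'a) set \<Rightarrow> ((nat \<Rightarrow> 'a) \<Rightarrow> 'b) \<Rightarrow> (nat \<Rightarrow> 'a) set" where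
  "condensation S f = {s \<in> S. \<forall>m. uncountable (f ` (S \<inter> cyl s m))}"

text \<open>There are only countably many cylinders, and each point of \<open>S\<close> outside the
  condensation set lies in one whose trace on \<open>S\<close> has a countable image.\<close>

lemma countable_image_non_condensation:
  fixes S :: "(nat \<Rightarrow> 'a::countable) set"
  shows "countable (f ` (S - condensation S f))"
proof -
  define \<C> where "\<C> = {A \<in> range (\<lambda>(s::nat \<Rightarrow> 'a, m). cyl s m). countable (f ` (S \<inter> A))}"
  have "countable (\<Union>A\<in>\<C>. f ` (S \<inter> A))"
    unfolding \<C>_def using countable_cylinders by (intro countable_UN countable_Collect) auto
  moreover have "f ` (S - condensation S f) \<subseteq> (\<Union>A\<in>\<C>. f ` (S \<inter> A))"
  proof
    fix y
    assume "y \<in> f ` (S - condensation S f)"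
    then obtain s m where "s \<in> S" "y = f s" "countable (f ` (S \<inter> cyl s m))"
      by (auto simp: condensation_def)
    moreover have "s \<in> cyl s m"
      by (simp add: mem_cyl)
    ultimately show "y \<in> (\<Union>A\<in>\<C>. f ` (S \<inter> A))"
      unfolding \<C>_def by blast
  qed
  ultimately show ?thesis
    using countable_subset by blast
qed

lemma uncountable_condensation_cyl:
  fixes S :: "(nat \<Rightarrow> 'a::countable) set"
  assumes "uncountable (f ` (S \<inter> A))"
  shows "uncountable (f ` (condensation S f \<inter> A))"
proof
  assume "countable (f ` (condensation S f \<inter> A))"
  then have "countable (f ` (S - condensation S f) \<union> f ` (condensation S f \<inter> A))"
    using countable_image_non_condensation by blast
  moreover have "f ` (S \<inter> A) \<subseteq> f ` (S - condensation S f) \<union> f ` (condensation S f \<inter> A)"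
    by blast
  ultimately show False
    using assms countable_subset by blast
qed

lemma condensation_nonempty:
  fixes S :: "(nat \<Rightarrow> 'a::countable) set"
  assumes "uncountable (f ` S)"
  shows "condensation S f \<noteq> {}"
  using uncountable_condensation_cyl[of f S UNIV] assms by auto

text \<open>Passing from \<open>S\<close> to its condensation points loses only countably many
  values of \<open>f\<close>, so the image of a cylinder around such a point stays
  uncountable.\<close>

lemma nowhere_locally_constant_condensation:
  fixes S :: "(nat \<Rightarrow> 'a::countable) set"
  shows "nowhere_locally_constant_on (condensation S f) f"
  unfolding nowhere_locally_constant_on_def
proof (intro ballI allI, rule ccontr)
  fix s m
  assume s: "s \<in> condensation S f"
    and const: "\<not> (\<exists>t\<in>condensation S f \<inter> cyl s m. \<exists>u\<in>condensation S f \<inter> cyl s m. f t \<noteq> f u)"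
  have "s \<in> condensation S f \<inter> cyl s m"
    using s by (simp add: mem_cyl)
  then have "f ` (condensation S f \<inter> cyl s m) \<subseteq> {f s}"
    using const by blast
  then have "countable (f ` (condensation S f \<inter> cyl s m))"
    by (rule countable_subset) simp
  then show False
    using s uncountable_condensation_cyl[of f S "cyl s m"] by (auto simp: condensation_def)
qed

section \<open>Category argument and two-colourings\<close>

text \<open>This is the Baire category theorem for sequences over a discrete set: each
  \<open>Q k\<close> is dense and open, and nested cylinders shrink to a sequence that satisfies
  them all.\<close>

lemma generic_sequence:
  fixes Q :: "nat \<Rightarrow> (nat \<Rightarrow> 'a) \<Rightarrow> bool"
  assumes dense: "\<And>k a l. \<exists>b\<in>cyl a l. Q k b"
    and nbhd: "\<And>k b. Q k b \<Longrightarrow> \<exists>l. \<forall>c\<in>cyl b l. Q k c"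
  shows "\<exists>a. \<forall>k. Q k a"
proof -
  have "\<exists>f. \<forall>k. True \<and> snd (f k) < snd (f (Suc k)) \<and>
      fst (f (Suc k)) \<in> cyl (fst (f k)) (snd (f k)) \<and>
      (\<forall>c\<in>cyl (fst (f (Suc k))) (snd (f (Suc k))). Q k c)"
  proof (rule dependent_nat_choice)
    fix x :: "(nat \<Rightarrow> 'a) \<times> nat" and k
    obtain b where b: "b \<in> cyl (fst x) (snd x)" "Q k b"
      using dense by blast
    obtain l where "\<forall>c\<in>cyl b l. Q k c"
      using nbhd[OF b(2)] by blast
    \<comment> \<open>The bound \<open>Suc (snd x)\<close> makes the prefix lengths strictly
      increase, so that the nested cylinders determine every entry of the limit.\<close>
    then have "\<forall>c\<in>cyl b (max l (Suc (snd x))). Q k c"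
      using cyl_antimono[of l "max l (Suc (snd x))" b] by auto
    then show "\<exists>y. True \<and> snd x < snd y \<and> fst y \<in> cyl (fst x) (snd x) \<and>
        (\<forall>c\<in>cyl (fst y) (snd y). Q k c)"
      using b(1) by (intro exI[of _ "(b, max l (Suc (snd x)))"]) auto
  qed simp
  then obtain f where less: "\<And>k. snd (f k) < snd (f (Suc k))"
    and agree: "\<And>k. fst (f (Suc k)) \<in> cyl (fst (f k)) (snd (f k))"
    and Q: "\<And>k c. c \<in> cyl (fst (f (Suc k))) (snd (f (Suc k))) \<Longrightarrow> Q k c"
    by blast
  have le: "k \<le> j \<Longrightarrow> snd (f k) \<le> snd (f j)" for j k
    by (rule lift_Suc_mono_le[of "\<lambda>k. snd (f k)"]) (simp_all add: less less_imp_le)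
  have ge: "k \<le> snd (f k)" for k
  proof (induction k)
    case (Suc k)
    then show ?case
      using less[of k] by simp
  qed simp
  have agree_le: "fst (f j) \<in> cyl (fst (f k)) (snd (f k))" if "k \<le> j" for j k
    using that
  proof (induction j rule: dec_induct)
    case base
    then show ?case
      by (simp add: mem_cyl)
  next
    case (step j)
    then show ?case
      using agree[of j] le[of k j] by (simp add: mem_cyl)
  qed
  define a where "a i = fst (f (Suc i)) i" for i
  have "a \<in> cyl (fst (f k)) (snd (f k))" for k
    unfolding mem_cyl
  proof (intro allI impI)
    fix i
    assume i: "i < snd (f k)"
    show "a i = fst (f k) i"
    proof (cases "Suc i \<le> k")
      case True
      then show ?thesis
        using agree_le[OF True] ge[of "Suc i"] by (simp add: mem_cyl a_def)
    next
      case False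
      then show ?thesis
        using agree_le[of k "Suc i"] i by (simp add: mem_cyl a_def)
    qed
  qed
  then show ?thesis
    using Q by blast
qed

text \<open>Thresholds \<open>k < l\<close> already separate the points of \<open>U\<close>: where
  two members differ, the smaller value is below \<open>l\<close> and, used as threshold, tells them
  apart. So \<open>U\<close> embeds into the lists over a countable set.\<close>

lemma countable_if_all_thresholds_countable:
  fixes U :: "(nat \<Rightarrow> nat) set"
  assumes bounded: "\<And>s t n. s \<in> U \<Longrightarrow> t \<in> U \<Longrightarrow> s n \<noteq> t n \<Longrightarrow> s n < l"
    and countable: "\<And>k. countable ((\<lambda>s. (\<lambda>v. v \<le> k) \<circ> s) ` U)"
  shows "countable U"
proof -
  define F where "F s = map (\<lambda>k. (\<lambda>v. v \<le> k) \<circ> s) [0..<l]" for s :: "nat \<Rightarrow> nat"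
  have "F ` U \<subseteq> lists (\<Union>k. (\<lambda>s. (\<lambda>v. v \<le> k) \<circ> s) ` U)"
    unfolding F_def by auto blast
  then have "countable (F ` U)"
    by (rule countable_subset) (simp add: countable)
  moreover have "inj_on F U"
  proof (rule inj_onI, rule ext, rule ccontr)
    fix s t n
    assume st: "s \<in> U" "t \<in> U" "F s = F t" and ne: "s n \<noteq> t n"
    define k where "k = min (s n) (t n)"
    have "k < l"
      using bounded[of s t n] st ne by (auto simp: k_def)
    then have "(\<lambda>v. v \<le> k) \<circ> s = (\<lambda>v. v \<le> k) \<circ> t"
      using st(3) by (auto simp: F_def)
    then show False
      using ne by (auto simp: k_def min_def fun_eq_iff split: if_splits dest: spec[of _ n])
  qed
  ultimately show ?thesis
    using countable_image_inj_on by blast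
qed

lemma uncountable_two_colouring:
  fixes S :: "(nat \<Rightarrow> nat) set"
  assumes "uncountable S"
  obtains a :: "nat \<Rightarrow> bool" and P
  where "P \<subseteq> S" and "P \<noteq> {}" and "nowhere_locally_constant_on P (\<lambda>s. a \<circ> s)"
proof -
  define P where "P = condensation S (\<lambda>s. s)"
  have P: "P \<subseteq> S" "P \<noteq> {}"
    using condensation_nonempty[of "\<lambda>s. s" S] assms by (auto simp: P_def condensation_def)
  have uncountable_P: "uncountable (P \<inter> cyl s m)" if "s \<in> P" for s m
    using uncountable_condensation_cyl[of "\<lambda>s. s" S "cyl s m"] that by (auto simp: P_def condensation_def)
  define sep where "sep A a \<longleftrightarrow> (\<exists>t\<in>P \<inter> A. \<exists>u\<in>P \<inter> A. a \<circ> t \<noteq> a \<circ> u)"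
    for A and a :: "nat \<Rightarrow> bool"
  show thesis
  \<comment> \<open>The first case says that \<open>sep (cyl s m)\<close> fails to be dense among
    the colourings for some \<open>s\<close> in \<open>P\<close>; in the second, a generic colouring
    works.\<close>
  proof (cases "\<exists>s\<in>P. \<exists>m l a. \<forall>b\<in>cyl a l. \<not> sep (cyl s m) b")
    case True
    then obtain s m l a where s: "s \<in> P" and const: "\<And>b. b \<in> cyl a l \<Longrightarrow> \<not> sep (cyl s m) b"
      by blast
    define U where "U = P \<inter> cyl s m"
    have "t n < l" if tu: "t \<in> U" "u \<in> U" "t n \<noteq> u n" for t u n
    proof (rule ccontr)
      assume "\<not> t n < l"
      \<comment> \<open>This \<open>b\<close> agrees with \<open>a\<close> below \<open>l\<close>,
        as \<open>t n\<close> is at least \<open>l\<close>, and gives \<open>t n\<close> the colour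
        opposite to that of \<open>u n\<close>; thus it separates \<open>t\<close> from
        \<open>u\<close>.\<close>
      define b where "b = a(t n := \<not> a (u n))"
      then have "b \<in> cyl a l"
        using \<open>\<not> t n < l\<close> by (simp add: mem_cyl)
      then have "b \<circ> t = b \<circ> u"
        using const tu(1,2) unfolding sep_def U_def by blast
      then have "b (t n) = b (u n)"
        by (metis comp_apply)
      then show False
        using tu(3) by (simp add: b_def)
    qed
    moreover have "uncountable U"
      using uncountable_P s by (simp add: U_def)
    ultimately obtain k where k: "uncountable ((\<lambda>s. (\<lambda>v. v \<le> k) \<circ> s) ` U)"
      using countable_if_all_thresholds_countable[of U l] by metis
    have "U \<subseteq> S"
      using P by (auto simp: U_def)
    then have "uncountable ((\<lambda>s. (\<lambda>v. v \<le> k) \<circ> s) ` S)"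
      using k countable_subset image_mono by metis
    \<comment> \<open>The set delivered here is not the local \<open>P\<close> but the condensation
      set of \<open>S\<close> with respect to the threshold colouring.\<close>
    then show thesis
      using that[OF _ condensation_nonempty nowhere_locally_constant_condensation]
      by (auto simp: condensation_def)
  next
    case False
    define \<C> where "\<C> = {cyl s m |s m. s \<in> P}"
    define A where "A = from_nat_into \<C>"
    have "\<C> \<subseteq> range (\<lambda>(s::nat \<Rightarrow> nat, m). cyl s m)"
      by (auto simp: \<C>_def)
    then have "countable \<C>"
      using countable_subset countable_cylinders by blast
    moreover have "\<C> \<noteq> {}"
      using P by (auto simp: \<C>_def)
    ultimately have A: "range A = \<C>"
      unfolding A_def by (intro range_from_nat_into)
    have "\<exists>a. \<forall>k. sep (A k) a"
    proof (rule generic_sequence[of "\<lambda>k. sep (A k)"])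
      fix k l and a :: "nat \<Rightarrow> bool"
      have "A k \<in> \<C>"
        using A by blast
      then show "\<exists>b\<in>cyl a l. sep (A k) b"
        using False by (auto simp: \<C>_def)
    next
      fix k and b :: "nat \<Rightarrow> bool"
      assume "sep (A k) b"
      then obtain t u n where tu: "t \<in> P \<inter> A k" "u \<in> P \<inter> A k" "b (t n) \<noteq> b (u n)"
        by (auto simp: sep_def fun_eq_iff)
      \<comment> \<open>Separation is witnessed by the two colours \<open>b (t n)\<close> and
        \<open>b (u n)\<close> alone, so it is an open condition on the colouring.\<close>
      have "sep (A k) c" if "c \<in> cyl b (Suc (max (t n) (u n)))" for c
      proof -
        have "(c \<circ> t) n \<noteq> (c \<circ> u) n"
          using that tu(3) by (simp add: mem_cyl)
        then show ?thesis
          using tu(1,2) unfolding sep_def by metis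
      qed
      then show "\<exists>l. \<forall>c\<in>cyl b l. sep (A k) c"
        by blast
    qed
    then obtain a where a: "\<And>k. sep (A k) a"
      by blast
    have "sep (cyl s m) a" if "s \<in> P" for s m
    proof -
      have "cyl s m \<in> range A"
        using that by (auto simp: A \<C>_def)
      then show ?thesis
        using a by auto
    qed
    then have "nowhere_locally_constant_on P (\<lambda>s. a \<circ> s)"
      by (simp add: nowhere_locally_constant_on_def sep_def)
    with that P show thesis
      by blast
  qed
qed

section \<open>Cardinality, generated semigroups and the construction of \<open>T\<close>\<close>

lemma uncountable_nat_set: "uncountable (UNIV :: nat set set)"
proof
  assume "countable (UNIV :: nat set set)"
  then have "range (from_nat_into (UNIV :: nat set set)) = Pow UNIV"
    by (simp add: range_from_nat_into)
  then show False
    using Cantors_theorem by blast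
qed

lemma subsemigroup_hull: "subsemigroup (subsemigroup hull X)"
  unfolding hull_def subsemigroup_def by blast

lemma comp_in_hull:
  assumes "f \<in> subsemigroup hull X" "g \<in> subsemigroup hull X"
  shows "f \<circ> g \<in> subsemigroup hull X"
  using subsemigroup_hull assms unfolding subsemigroup_def by blast

theorem theorem3p1:
  fixes S :: "(nat \<Rightarrow> nat) set"
  assumes "subsemigroup S"
    and "closed S"
    and "S \<approx> (UNIV :: nat set set)"
  shows "\<exists>T. subsemigroup T \<and> T \<subseteq> F2 \<and> closed T \<and> T \<approx> (UNIV :: nat set set) \<and> T \<preccurlyeq> S"
proof -
  have "uncountable S"
    using assms(3) uncountable_nat_set countable_lepoll eqpoll_imp_lepoll eqpoll_sym by metis
  then obtain a :: "nat \<Rightarrow> bool" and P where P: "P \<subseteq> S" "P \<noteq> {}"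
    and a: "nowhere_locally_constant_on P (\<lambda>s. a \<circ> s)"
    using uncountable_two_colouring by metis
  obtain g :: "(nat \<Rightarrow> bool) \<Rightarrow> nat \<Rightarrow> nat" where cont: "continuous_on UNIV g"
    and approx: "\<And>x k. \<exists>t\<in>P. t \<in> cyl (g x) k" and inj: "inj (\<lambda>x. a \<circ> g x)"
    using cantor_scheme[OF P(2) a] by metis
  have g_in: "g x \<in> S" for x
    using approx P(1) by (intro mem_closed_if_approximated[OF assms(2)]) blast
  define c :: "nat \<Rightarrow> nat" where "c v = of_bool (a v)" for v
  \<comment> \<open>Truncated subtraction sends both \<open>0\<close> and \<open>1\<close> to
    \<open>0\<close>, which makes every \<open>h x\<close> agree there, while
    \<open>d (n + 2) = n\<close> keeps every entry of \<open>g x\<close> visible.\<close>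
  define d :: "nat \<Rightarrow> nat" where "d n = n - 2" for n
  define h where "h x = c \<circ> g x \<circ> d" for x
  define T where "T = range h \<union> {\<lambda>_. 0, \<lambda>_. 1}"
  have T_01: "f n = 0 \<or> f n = 1" if "f \<in> T" for f n
    using that by (auto simp: T_def h_def c_def)
  have T_eq: "f 0 = f (Suc 0)" if "f \<in> T" for f
    using that by (auto simp: T_def h_def d_def)
  have inj_h: "inj h"
  proof (rule injI)
    fix x y
    assume "h x = h y"
    then have "h x (n + 2) = h y (n + 2)" for n
      by simp
    then have "a \<circ> g x = a \<circ> g y"
      by (auto simp: h_def c_def d_def fun_eq_iff of_bool_eq_iff)
    then show "x = y"
      using inj by (metis injD)
  qed
  have "subsemigroup T"
    unfolding subsemigroup_def
  proof (intro ballI)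
    fix f f'
    assume f: "f \<in> T" "f' \<in> T"
    \<comment> \<open>The values of \<open>f'\<close> are \<open>0\<close> and \<open>1\<close>,
      where \<open>f\<close> takes one and the same value; the composite is thus one of the two
      added constant maps.\<close>
    have "f \<circ> f' = (\<lambda>_. f 0)"
      using T_eq[OF f(1)] T_01[OF f(2)] by (auto simp: fun_eq_iff) (metis One_nat_def)
    then show "f \<circ> f' \<in> T"
      using T_01[OF f(1), of 0] by (auto simp: T_def)
  qed
  moreover have "T \<subseteq> F2"
  proof
    fix f
    assume "f \<in> T"
    then have "range f \<subseteq> {0, 1}"
      using T_01[of f] by (simp add: image_subset_iff)
    then show "f \<in> F2"
      unfolding F2_def using card_mono[of "{0, 1::nat}" "range f"] finite_subset[of "range f" "{0, 1}"]
      by simp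
  qed
  moreover have "closed T"
  proof -
    have "continuous_on UNIV h"
    proof (rule continuous_on_coordinatewise_then_product)
      fix i
      have "continuous_on UNIV (\<lambda>x. g x (d i))"
        using cont by (rule continuous_on_product_then_coordinatewise)
      then show "continuous_on UNIV (\<lambda>x. h x i)"
        unfolding h_def comp_def
        by (rule continuous_on_compose2[of UNIV c, rotated]) auto
    qed
    then have "compact (range h)"
      using compact_UNIV_nat_bool compact_continuous_image by blast
    then show ?thesis
      unfolding T_def by (intro compact_imp_closed_fun compact_Un) (auto intro: finite_imp_compact)
  qed
  moreover have "T \<approx> (UNIV :: nat set set)"
  proof (rule lepoll_antisym)
    \<comment> \<open>A map into \<open>{0, 1}\<close> is determined by the set where it is
      \<open>1\<close>, which gives the upper bound; the lower bound comes from Cantor space through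
      \<open>h\<close>.\<close>
    have "inj_on (\<lambda>f. {n. f n = 1}) T"
    proof (rule inj_onI, rule ext)
      fix f f' :: "nat \<Rightarrow> nat" and n
      assume f: "f \<in> T" "f' \<in> T" and "{n. f n = 1} = {n. f' n = 1}"
      then have "f n = 1 \<longleftrightarrow> f' n = 1"
        by blast
      then show "f n = f' n"
        using T_01[OF f(1), of n] T_01[OF f(2), of n] by auto
    qed
    then show "T \<lesssim> (UNIV :: nat set set)"
      unfolding lepoll_def by blast
    have "inj (\<lambda>X. h (\<lambda>n. n \<in> X))"
      using inj_h by (auto simp: inj_def fun_eq_iff)
    then show "(UNIV :: nat set set) \<lesssim> T"
      unfolding lepoll_def T_def by blast
  qed
  moreover have "T \<preccurlyeq> S"
    unfolding gen_le_def
  proof (intro exI conjI)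
    let ?C = "{c, d, \<lambda>_. 0, \<lambda>_. 1}"
    show "countable ?C"
      by simp
    have "h x \<in> subsemigroup hull (S \<union> ?C)" for x
      unfolding h_def using g_in by (intro comp_in_hull hull_inc) auto
    moreover have "{\<lambda>_. 0, \<lambda>_. 1} \<subseteq> subsemigroup hull (S \<union> ?C)"
      using hull_subset[of "S \<union> ?C" subsemigroup] by blast
    ultimately show "T \<subseteq> subsemigroup hull (S \<union> ?C)"
      unfolding T_def by blast
  qed
  ultimately show ?thesis
    by blast
qed

end
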